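(* Let $\mathcal{A}$ be a Rickart *-ring and $a,b\in\mathcal{A}$. Put $b_r=\mathrm{rp}(b)\,b$. Then: (a) $a\preceq^{r*|\ell\square} b$ if and only if there exists $p\in E(\mathcal{A})$ such that $a=bp$, $p\le\mathrm{rp}(b)$ and $pb_rp=pb_r$; (b) $a\preceq^{r*|r\square} b$ if and only if there exists $p\in E(\mathcal{A})$ such that $a=bp$, $p\le\mathrm{rp}(b)$ and $pb_rp=b_rp$; (c) $a\preceq^{r*|\square} b$ if and only if there exists $p\in E(\mathcal{A})$ such that $a=bp$, $p\le\mathrm{rp}(b)$ and $pb_r=b_rp$. Moreover, in each case, the element $p$ is unique.
   Context: A *-ring is an (associative) ring $\mathcal{A}$ with an involution $*$: $(a+b)^*=a^*+b^*$, $(ab)^*=b^*a^*$, $(a^* )^*=a$. It is a Rickart *-ring if for every $a\in\mathcal{A}$ there is a self-adjoint idempotent $p$ (i.e. $p=p^*=p^2$) with $\{x\in\mathcal{A}: xa=0\}=\mathcal{A}(1-p)$; such a ring has an identity $1$, and $p$ is unique and denoted $\mathrm{lp}(a)$. Likewise, for every $a$ there is a unique self-adjoint idempotent $\mathrm{rp}(a)$ with $\{x\in\mathcal{A}: ax=0\}=(1-\mathrm{rp}(a))\mathcal{A}$. $E(\mathcal{A})$ is the set of self-adjoint idempotents, partially ordered by $p\le q$ iff $p=pq$. Partial orders on $\mathcal{A}$: $a\preceq^{r*|\ell\square} b$ iff $a\,\mathrm{rp}(b)=a=b\,\mathrm{rp}(a)$ and $a^2=ab$; $a\preceq^{r*|r\square}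 b$ iff $a\,\mathrm{rp}(b)=a=b\,\mathrm{rp}(a)$ and $a^2=ba$; $a\preceq^{r*|\square} b$ iff $a\,\mathrm{rp}(b)=a=b\,\mathrm{rp}(a)$ and $a^2=ab=ba$. *)

theory Defs
  imports Main
begin

class star_ring = ring +
  fixes star :: "'a \<Rightarrow> 'a"
  assumes star_add: "star (a + b) = star a + star b"
    and star_mult: "star (a * b) = star b * star a"
    and star_star: "star (star a) = a"

definition projections :: "'a::star_ring set"
  where "projections = {p. p = star p \<and> p = p * p}"

definition proj_le :: "'a::star_ring \<Rightarrow> 'a \<Rightarrow> bool"
  where "proj_le p q \<longleftrightarrow> p = p * q"

(* The unit comes from monoid_mult rather than ring_1, so that the zero ring, where 0 = 1,
   is not excluded. *)
class rickart_star_ring = star_ring + monoid_mult +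
  assumes rickart: "\<exists>p. p = star p \<and> p = p * p \<and> {x. x * a = 0} = {y * (1 - p) | y. True}"

definition rp :: "'a::rickart_star_ring \<Rightarrow> 'a"
  where "rp a = (THE p. p \<in> projections \<and> {x. a * x = 0} = {(1 - p) * y | y. True})"

lemma rp_ex1:
  fixes a :: "'a::rickart_star_ring"
  shows "\<exists>!p. p \<in> projections \<and> {x. a * x = 0} = {(1 - p) * y | y. True}"
proof -
  have s0: "star (0::'a) = 0"
    using star_add[of "0::'a" 0] by simp
  have s1: "star (1::'a) = 1"
    by (metis mult.right_neutral star_mult star_star)
  have sm: "star (1 - p) = 1 - star p" for p :: 'a
    using star_add[of "1 - p" p] s1 by (simp add: eq_diff_eq)
  obtain p where p: "p = star p" "p = p * p"
    and ann: "{x. x * star a = 0} = {y * (1 - p) | y. True}"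
    using rickart[of "star a"] by blast
  have "a * x = 0 \<longleftrightarrow> (\<exists>y. x = (1 - p) * y)" for x
  proof -
    have "a * x = 0 \<longleftrightarrow> star x * star a = 0"
      by (metis s0 star_mult star_star)
    also have "\<dots> \<longleftrightarrow> (\<exists>y. star x = y * (1 - p))"
      using ann by blast
    also have "\<dots> \<longleftrightarrow> (\<exists>y. x = (1 - p) * y)"
      by (metis p(1) sm star_mult star_star)
    finally show ?thesis .
  qed
  then have ex: "p \<in> projections \<and> {x. a * x = 0} = {(1 - p) * y | y. True}"
    using p unfolding projections_def by auto
  have le: "q = r * q"
    if q: "q \<in> projections" and r: "r \<in> projections"
      and eq: "{(1 - r) * y | y. True} = {(1 - q) * y | y. True}" for q r :: 'a
  proof -
    have "1 - r \<in> {(1 - q) * y | y. True}"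
      using eq by (metis (mono_tags, lifting) mem_Collect_eq mult.right_neutral)
    then obtain y where "1 - r = (1 - q) * y"
      by blast
    moreover have "q * (1 - q) = 0"
      using q unfolding projections_def by (simp add: right_diff_distrib)
    ultimately have "q * (1 - r) = 0"
      by (metis mult.assoc mult_zero_left)
    then have "q = q * r"
      by (simp add: right_diff_distrib)
    then show "q = r * q"
      using q r star_mult[of q r] unfolding projections_def by simp
  qed
  show ?thesis
  proof (rule ex1I[where a = p])
    show "p \<in> projections \<and> {x. a * x = 0} = {(1 - p) * y | y. True}"
      by (fact ex)
  next
    fix q
    assume q: "q \<in> projections \<and> {x. a * x = 0} = {(1 - q) * y | y. True}"
    have "q = p * q" and "p = q * p"
      using le[of q p] le[of p q] ex q by auto
    moreover have "star (p * q) = q * p"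
      using ex q star_mult[of p q] unfolding projections_def by simp
    ultimately show "q = p"
      using q unfolding projections_def by auto
  qed
qed

definition left_order :: "'a::rickart_star_ring \<Rightarrow> 'a \<Rightarrow> bool"
  where "left_order a b \<longleftrightarrow> a * rp b = a \<and> a = b * rp a \<and> a\<^sup>2 = a * b"

definition right_order :: "'a::rickart_star_ring \<Rightarrow> 'a \<Rightarrow> bool"
  where "right_order a b \<longleftrightarrow> a * rp b = a \<and> a = b * rp a \<and> a\<^sup>2 = b * a"

definition two_sided_order :: "'a::rickart_star_ring \<Rightarrow> 'a \<Rightarrow> bool"
  where "two_sided_order a b \<longleftrightarrow> a * rp b = a \<and> a = b * rp a \<and> a\<^sup>2 = a * b \<and> a * b = b * a"

end

theory Submission
  imports Defs
begin

text \<open>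
  Since \<open>b * x = 0\<close> iff \<open>rp b * x = 0\<close>, left factors \<open>b\<close> in an equation may be traded for \<open>rp b\<close>.
  Consequently a projection \<open>p \<le> rp b\<close> with \<open>a = b * p\<close> has the same right annihilator
  as \<open>a\<close>, so it must be \<open>rp a\<close>. Trading \<open>b\<close> for \<open>rp b\<close> in \<open>b * p * b * p = b * p * b\<close> and
  \<open>b * p * b * p = b * b * p\<close> then yields the conditions on \<open>p * b_r\<close> and \<open>b_r * p\<close>.
\<close>

lemma rp_spec:
  fixes a :: "'a::rickart_star_ring"
  shows "rp a \<in> projections" and "{x. a * x = 0} = {(1 - rp a) * y | y. True}"
  using theI'[OF rp_ex1[of a]] unfolding rp_def by blast+

lemma projection_idem: "p \<in> projections \<Longrightarrow> p * p = p"
  unfolding projections_def by simp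

text \<open>This puts the annihilator of a projection in the form that characterises
  \<open>rp\<close>, so that annihilators of \<open>a\<close> and \<open>rp a\<close> can be
  compared.\<close>

lemma projection_ann:
  fixes p :: "'a::rickart_star_ring"
  assumes "p \<in> projections"
  shows "{x. p * x = 0} = {(1 - p) * y | y. True}"
proof -
  have "p * ((1 - p) * y) = 0" for y
    using projection_idem[OF assms] by (simp add: left_diff_distrib right_diff_distrib flip: mult.assoc)
  moreover have "x = (1 - p) * x" if "p * x = 0" for x
    using that by (simp add: left_diff_distrib)
  ultimately show ?thesis
    by blast
qed

text \<open>Both equations say that \<open>x\<close> lies in the right ideal generated by
  \<open>1 - rp a\<close>.\<close>

lemma mult_eq_0_iff_rp:
  fixes a :: "'a::rickart_star_ring"
  shows "a * x = 0 \<longleftrightarrow> rp a * x = 0"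
  using rp_spec(2)[of a] projection_ann[OF rp_spec(1)[of a]] by blast

lemma mult_left_eq_iff_rp:
  fixes b :: "'a::rickart_star_ring"
  shows "b * x = b * y \<longleftrightarrow> rp b * x = rp b * y"
  using mult_eq_0_iff_rp[of b "x - y"] by (simp add: right_diff_distrib)

lemma rp_eqI:
  fixes a :: "'a::rickart_star_ring"
  assumes "p \<in> projections" and "\<And>x. a * x = 0 \<longleftrightarrow> p * x = 0"
  shows "p = rp a"
proof -
  have "{x. a * x = 0} = {(1 - p) * y | y. True}"
    using projection_ann[OF assms(1)] assms(2) by simp
  then show ?thesis
    using rp_ex1[of a] rp_spec[of a] assms(1) by blast
qed

text \<open>Applying \<open>star\<close> to \<open>p = p * q\<close> reverses the product.\<close>

lemma proj_le_commute:
  assumes "p \<in> projections" "q \<in> projections" "proj_le p q"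
  shows "q * p = p"
proof -
  have "star p = star q * star p"
    using assms(3) star_mult[of p q] unfolding proj_le_def by simp
  then show ?thesis
    using assms(1,2) unfolding projections_def by simp
qed

text \<open>In \<open>b * (p * x) = 0\<close> the factor \<open>b\<close> may become
  \<open>rp b\<close>, which \<open>p\<close> absorbs; so \<open>b * p\<close> and \<open>p\<close>
  have the same right annihilator.\<close>

lemma rp_mult_projection:
  fixes b :: "'a::rickart_star_ring"
  assumes "p \<in> projections" "proj_le p (rp b)"
  shows "p = rp (b * p)"
  using assms(1)
proof (rule rp_eqI)
  show "b * p * x = 0 \<longleftrightarrow> p * x = 0" for x
    using mult_eq_0_iff_rp[of b "p * x"] proj_le_commute[OF assms(1) rp_spec(1) assms(2)]
    by (metis mult.assoc)
qed

text \<open>Trade the left factor \<open>a\<close> for \<open>rp a\<close> in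
  \<open>a * rp b = a * 1\<close>.\<close>

lemma proj_le_rp_iff:
  fixes a b :: "'a::rickart_star_ring"
  shows "proj_le (rp a) (rp b) \<longleftrightarrow> a * rp b = a"
  using mult_left_eq_iff_rp[of a "rp b" 1] unfolding proj_le_def by auto

lemma square_eq_iff:
  fixes a b p :: "'a::rickart_star_ring"
  assumes p: "p \<in> projections" "proj_le p (rp b)" and a: "a = b * p"
  shows "a\<^sup>2 = a * b \<longleftrightarrow> p * (rp b * b) * p = p * (rp b * b)"
    and "a\<^sup>2 = b * a \<longleftrightarrow> p * (rp b * b) * p = rp b * b * p"
proof -
  have qp: "rp b * (p * x) = p * x" for x
    using proj_le_commute[OF p(1) rp_spec(1) p(2)] by (metis mult.assoc)
  have pq: "p * (rp b * x) = p * x" for x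
    using p(2) unfolding proj_le_def by (metis mult.assoc)
  show "a\<^sup>2 = a * b \<longleftrightarrow> p * (rp b * b) * p = p * (rp b * b)"
    using mult_left_eq_iff_rp[of b "p * (b * p)" "p * b"]
    by (simp add: a power2_eq_square mult.assoc qp pq)
  \<comment> \<open>Here the right side is \<open>b * (b * p)\<close>: trading its first
    \<open>b\<close> leaves an \<open>rp b\<close> that no \<open>p\<close> absorbs, whence
    \<open>rp b * b\<close> instead of \<open>b\<close>.\<close>
  show "a\<^sup>2 = b * a \<longleftrightarrow> p * (rp b * b) * p = rp b * b * p"
    using mult_left_eq_iff_rp[of b "p * (b * p)" "b * p"]
    by (simp add: a power2_eq_square mult.assoc qp pq)
qed

text \<open>Multiply \<open>p * c = c * p\<close> by \<open>p\<close> on either side; conversely,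
  both products equal \<open>p * c * p\<close>.\<close>

lemma projection_commute_iff:
  assumes "p \<in> projections"
  shows "p * c = c * p \<longleftrightarrow> p * c * p = p * c \<and> p * c * p = c * p"
  using projection_idem[OF assms] by (metis mult.assoc)

text \<open>The only possible witness is \<open>rp (b * p) = rp a\<close>, so the quantifier
  collapses. Keeping \<open>P\<close> arbitrary serves all three orders at once.\<close>

lemma ex_projection_iff:
  fixes a b :: "'a::rickart_star_ring"
  shows "(\<exists>p \<in> projections. a = b * p \<and> proj_le p (rp b) \<and> P p) \<longleftrightarrow>
    a * rp b = a \<and> a = b * rp a \<and> P (rp a)"
  using rp_mult_projection[of _ b] proj_le_rp_iff[of a b] rp_spec(1)[of a] by metis

lemma Uniq_projection:
  fixes a b :: "'a::rickart_star_ring"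
  shows "\<exists>\<^sub>\<le>\<^sub>1 p. p \<in> projections \<and> a = b * p \<and> proj_le p (rp b) \<and> P p"
  unfolding Uniq_def using rp_mult_projection[of _ b] by metis

theorem corollary20:
  fixes a b b_r :: "'a::rickart_star_ring"
  assumes "b_r = rp b * b"
  shows "((left_order a b \<longleftrightarrow>
        (\<exists>p \<in> projections. a = b * p \<and> proj_le p (rp b) \<and> p * b_r * p = p * b_r)) \<and>
      (\<exists>\<^sub>\<le>\<^sub>1 p. p \<in> projections \<and> a = b * p \<and> proj_le p (rp b) \<and> p * b_r * p = p * b_r)) \<and>
    ((right_order a b \<longleftrightarrow>
        (\<exists>p \<in> projections. a = b * p \<and> proj_le p (rp b) \<and> p * b_r * p = b_r * p)) \<and>
      (\<exists>\<^sub>\<le>\<^sub>1 p. p \<in> projections \<and> a = b * p \<and> proj_le p (rp b) \<and> p * b_r * p = b_r * p)) \<and>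
    ((two_sided_order a b \<longleftrightarrow>
        (\<exists>p \<in> projections. a = b * p \<and> proj_le p (rp b) \<and> p * b_r = b_r * p)) \<and>
      (\<exists>\<^sub>\<le>\<^sub>1 p. p \<in> projections \<and> a = b * p \<and> proj_le p (rp b) \<and> p * b_r = b_r * p))"
proof -
  note sq = square_eq_iff[OF rp_spec(1)[of a], of b a, folded assms]
  note comm = projection_commute_iff[OF rp_spec(1)[of a], of b_r]
  have le: "proj_le (rp a) (rp b)" if "a * rp b = a"
    using that proj_le_rp_iff by blast
  have "left_order a b \<longleftrightarrow>
      (\<exists>p \<in> projections. a = b * p \<and> proj_le p (rp b) \<and> p * b_r * p = p * b_r)"
    unfolding ex_projection_iff left_order_def using sq(1) le by blast
  moreover have "right_order a b \<longleftrightarrow>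
      (\<exists>p \<in> projections. a = b * p \<and> proj_le p (rp b) \<and> p * b_r * p = b_r * p)"
    unfolding ex_projection_iff right_order_def using sq(2) le by blast
  moreover have "two_sided_order a b \<longleftrightarrow>
      (\<exists>p \<in> projections. a = b * p \<and> proj_le p (rp b) \<and> p * b_r = b_r * p)"
    \<comment> \<open>The order amounts to both \<open>a\<^sup>2 = a * b\<close> and
      \<open>a\<^sup>2 = b * a\<close>; \<open>sq\<close> turns these into the two halves of
      \<open>comm\<close>.\<close>
    unfolding ex_projection_iff two_sided_order_def using sq comm le by metis
  ultimately show ?thesis
    by (intro conjI Uniq_projection)
qed

end
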